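(* Let $\Psi=(E,\Delta)$ and $\Psi'=(E',\Delta')$ be ordered simplicial complexes in the class QC. (i) If $s(E,E')$ is a shuffle of $E$ and $E'$, then the join $\Psi*_{s(E,E')}\Psi'$ is in QC. (ii) If $U\subseteq E$ is any subset, then the restriction $\Psi|_U$ is in QC. (iii) If $v$ is a vertex of $\Psi$, then the contraction of $v$ in $\Psi$ is in QC. In particular, QC is a quasi-matroidal class.
   Context: An ordered simplicial complex is a pair $\Psi=(E,\Delta)$ with $E$ a finite totally ordered set and $\Delta\subseteq 2^E$ a simplicial complex (closed under taking subsets, $\emptyset\in\Delta$). Elements of $\Delta$ are independent sets; inclusion-maximal ones are bases; inclusion-minimal subsets of $E$ not in $\Delta$ are circuits. A complex is pure if all bases have the same cardinality. A loop is an element of $E$ in no basis; a vertex is an element of $E$ that is not a loop; a coloop is an element lying in every basis. Restriction: $\Psi|_U=(U,\{I\in\Delta: I\subseteq U\})$. Deletion of a non-coloop $e$: restriction to $E\setminus\{e\}$. Contraction of an independent set $I$: the ordered complex on $E\setminus I$ with independent sets $\{J\subseteq E\setminus I: J\cup I\in\Delta\}$; contraction of a vertex $v$ is contraction of $\{v\}$. A shuffle $s(E,E')$ is a totally ordered set with order-preserving injections $j:E\to s(E,E')$, $j':E'\to s(E,E')$ whose images are disjoint and cover $s(E,E')$. The join $\Psi*_{s(E,E')}\Psi'$ has ground set $s(E,E')$ and independent sets $j(I)\cup j'(I')$ with $I\in\Delta$, $I'\in\Delta'$. QC: the class of $\Psi$ such that if $C_1\neq C_2$ are circuits and $c\in C_1\cap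 C_2$ satisfies $c<\max (C_1\triangle C_2)$ (symmetric difference), then there is a circuit $C_3\subseteq (C_1\cup C_2)\setminus\{c\}$. An ordered matroid is an ordered complex $(E,\Delta)$ with $\Delta$ the independence complex of a matroid on $E$. $\Psi$ is shifted if whenever $B$ is a basis and $i<j$ in $E$ satisfy $i\notin B$, $j\in B$, then $(B\setminus\{j\})\cup\{i\}$ is a basis. A class $\mathcal A$ of ordered complexes is quasi-matroidal if: (1) every ordered matroid is in $\mathcal A$; (2) if $\Delta$ is a simplicial complex with vertex set $X$ such that $(E,\Delta)\in\mathcal A$ for every total ordering $E$ of $X$, then $\Delta$ is a matroid independence complex; (3) every pure shifted complex is in $\mathcal A$; (4) $\mathcal A$ is closed under joins (for every pair in $\mathcal A$ and every shuffle), under deletions (deleting the largest element of the ground set, when that deletion is defined), and under contractions (of every independent set). *)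

theory Defs
  imports Main
begin

text \<open>The total order is a reflexive relation carried by the ground set (and contained in its
  square), rather than a type class, because a single complex has to be considered with
  all orderings of its ground set.\<close>

record 'a ordered_complex =
  ground :: "'a set"
  order_rel :: "'a rel"
  indep :: "'a set set"

definition simplicial_complex :: "'a set \<Rightarrow> 'a set set \<Rightarrow> bool" where
  "simplicial_complex E \<Delta> \<longleftrightarrow>
     finite E \<and> \<Delta> \<subseteq> Pow E \<and> {} \<in> \<Delta> \<and> (\<forall>I\<in>\<Delta>. \<forall>J. J \<subseteq> I \<longrightarrow> J \<in> \<Delta>)"

definition ordered_complex :: "'a ordered_complex \<Rightarrow> bool" where
  "ordered_complex \<Psi> \<longleftrightarrow>
     simplicial_complex (ground \<Psi>) (indep \<Psi>) \<and> linear_order_on (ground \<Psi>) (order_rel \<Psi>)"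

definition lt :: "'a rel \<Rightarrow> 'a \<Rightarrow> 'a \<Rightarrow> bool" where
  "lt r x y \<longleftrightarrow> (x, y) \<in> r \<and> x \<noteq> y"

text \<open>Specified only if \<open>A\<close> has a greatest element, e.g. if \<open>A\<close> is a finite nonempty subset
  of the set linearly ordered by \<open>r\<close>.\<close>

definition max_wrt :: "'a rel \<Rightarrow> 'a set \<Rightarrow> 'a" where
  "max_wrt r A = (THE m. m \<in> A \<and> (\<forall>x\<in>A. (x, m) \<in> r))"

definition bases :: "'a set set \<Rightarrow> 'a set set" where
  "bases \<Delta> = {B \<in> \<Delta>. \<forall>I\<in>\<Delta>. B \<subseteq> I \<longrightarrow> I = B}"

definition circuits :: "'a set \<Rightarrow> 'a set set \<Rightarrow> 'a set set" where
  "circuits E \<Delta> = {C. C \<subseteq> E \<and> C \<notin> \<Delta> \<and> (\<forall>D. D \<subset> C \<longrightarrow> D \<in> \<Delta>)}"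

definition pure :: "'a set set \<Rightarrow> bool" where
  "pure \<Delta> \<longleftrightarrow> (\<forall>B\<in>bases \<Delta>. \<forall>B'\<in>bases \<Delta>. card B = card B')"

definition loops :: "'a set \<Rightarrow> 'a set set \<Rightarrow> 'a set" where
  "loops E \<Delta> = {e \<in> E. \<forall>B\<in>bases \<Delta>. e \<notin> B}"

definition vertices :: "'a set \<Rightarrow> 'a set set \<Rightarrow> 'a set" where
  "vertices E \<Delta> = E - loops E \<Delta>"

definition coloops :: "'a set \<Rightarrow> 'a set set \<Rightarrow> 'a set" where
  "coloops E \<Delta> = {e \<in> E. \<forall>B\<in>bases \<Delta>. e \<in> B}"

definition restriction :: "'a ordered_complex \<Rightarrow> 'a set \<Rightarrow> 'a ordered_complex" where
  "restriction \<Psi> U =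
     \<lparr>ground = U, order_rel = Restr (order_rel \<Psi>) U, indep = {I \<in> indep \<Psi>. I \<subseteq> U}\<rparr>"

text \<open>Meaningful only if \<open>e\<close> is not a coloop; this side condition is imposed where deletion is used.\<close>

definition deletion :: "'a ordered_complex \<Rightarrow> 'a \<Rightarrow> 'a ordered_complex" where
  "deletion \<Psi> e = restriction \<Psi> (ground \<Psi> - {e})"

definition contraction :: "'a ordered_complex \<Rightarrow> 'a set \<Rightarrow> 'a ordered_complex" where
  "contraction \<Psi> I =
     \<lparr>ground = ground \<Psi> - I, order_rel = Restr (order_rel \<Psi>) (ground \<Psi> - I),
      indep = {J. J \<subseteq> ground \<Psi> - I \<and> J \<union> I \<in> indep \<Psi>}\<rparr>"

definition shuffle ::
  "'a set \<Rightarrow> 'a rel \<Rightarrow> 'b set \<Rightarrow> 'b rel \<Rightarrow> 'c set \<Rightarrow> 'c rel \<Rightarrow> ('a \<Rightarrow> 'c) \<Rightarrow> ('b \<Rightarrow> 'c) \<Rightarrow> bool" where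
  "shuffle E r E' r' S s j j' \<longleftrightarrow>
     linear_order_on S s \<and>
     inj_on j E \<and> (\<forall>(x, y)\<in>r. (j x, j y) \<in> s) \<and>
     inj_on j' E' \<and> (\<forall>(x, y)\<in>r'. (j' x, j' y) \<in> s) \<and>
     j ` E \<inter> j' ` E' = {} \<and> j ` E \<union> j' ` E' = S"

definition join ::
  "'c set \<Rightarrow> 'c rel \<Rightarrow> ('a \<Rightarrow> 'c) \<Rightarrow> ('b \<Rightarrow> 'c) \<Rightarrow>
   'a ordered_complex \<Rightarrow> 'b ordered_complex \<Rightarrow> 'c ordered_complex" where
  "join S s j j' \<Psi> \<Psi>' =
     \<lparr>ground = S, order_rel = s, indep = {j ` I \<union> j' ` I' |I I'. I \<in> indep \<Psi> \<and> I' \<in> indep \<Psi>'}\<rparr>"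

definition QC :: "'a ordered_complex set" where
  "QC = {\<Psi>. ordered_complex \<Psi> \<and>
     (\<forall>C\<^sub>1 \<in> circuits (ground \<Psi>) (indep \<Psi>). \<forall>C\<^sub>2 \<in> circuits (ground \<Psi>) (indep \<Psi>).
        \<forall>c \<in> C\<^sub>1 \<inter> C\<^sub>2.
          C\<^sub>1 \<noteq> C\<^sub>2 \<and> lt (order_rel \<Psi>) c (max_wrt (order_rel \<Psi>) (sym_diff C\<^sub>1 C\<^sub>2)) \<longrightarrow>
          (\<exists>C\<^sub>3 \<in> circuits (ground \<Psi>) (indep \<Psi>). C\<^sub>3 \<subseteq> (C\<^sub>1 \<union> C\<^sub>2) - {c}))}"

definition matroid_complex :: "'a set \<Rightarrow> 'a set set \<Rightarrow> bool" where
  "matroid_complex E \<Delta> \<longleftrightarrow>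
     simplicial_complex E \<Delta> \<and>
     (\<forall>I\<in>\<Delta>. \<forall>J\<in>\<Delta>. card I < card J \<longrightarrow> (\<exists>x\<in>J - I. insert x I \<in> \<Delta>))"

definition ordered_matroid :: "'a ordered_complex \<Rightarrow> bool" where
  "ordered_matroid \<Psi> \<longleftrightarrow> ordered_complex \<Psi> \<and> matroid_complex (ground \<Psi>) (indep \<Psi>)"

definition shifted :: "'a ordered_complex \<Rightarrow> bool" where
  "shifted \<Psi> \<longleftrightarrow>
     (\<forall>B\<in>bases (indep \<Psi>). \<forall>i\<in>ground \<Psi>. \<forall>j\<in>ground \<Psi>.
        lt (order_rel \<Psi>) i j \<and> i \<notin> B \<and> j \<in> B \<longrightarrow> (B - {j}) \<union> {i} \<in> bases (indep \<Psi>))"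

text \<open>A class is a set of ordered complexes with ground sets in one type. Already for an
  infinite type such as \<open>nat\<close>, every ordered complex is represented up to isomorphism, and
  every shuffle of two ground sets can be realised.\<close>

definition quasi_matroidal :: "'a ordered_complex set \<Rightarrow> bool" where
  "quasi_matroidal \<A> \<longleftrightarrow>
     (\<forall>\<Psi>\<in>\<A>. ordered_complex \<Psi>) \<and>
     (\<forall>\<Psi>. ordered_matroid \<Psi> \<longrightarrow> \<Psi> \<in> \<A>) \<and>
     (\<forall>X \<Delta>. simplicial_complex X \<Delta> \<and> vertices X \<Delta> = X \<and>
        (\<forall>r. linear_order_on X r \<longrightarrow> \<lparr>ground = X, order_rel = r, indep = \<Delta>\<rparr> \<in> \<A>) \<longrightarrow>
        matroid_complex X \<Delta>) \<and>
     (\<forall>\<Psi>. ordered_complex \<Psi> \<and> pure (indep \<Psi>) \<and> shifted \<Psi> \<longrightarrow> \<Psi> \<in> \<A>) \<and>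
     (\<forall>\<Psi>\<in>\<A>. \<forall>\<Psi>'\<in>\<A>. \<forall>S s j j'.
        shuffle (ground \<Psi>) (order_rel \<Psi>) (ground \<Psi>') (order_rel \<Psi>') S s j j' \<longrightarrow>
        join S s j j' \<Psi> \<Psi>' \<in> \<A>) \<and>
     (\<forall>\<Psi>\<in>\<A>. ground \<Psi> \<noteq> {} \<and>
        max_wrt (order_rel \<Psi>) (ground \<Psi>) \<notin> coloops (ground \<Psi>) (indep \<Psi>) \<longrightarrow>
        deletion \<Psi> (max_wrt (order_rel \<Psi>) (ground \<Psi>)) \<in> \<A>) \<and>
     (\<forall>\<Psi>\<in>\<A>. \<forall>I\<in>indep \<Psi>. contraction \<Psi> I \<in> \<A>)"

end

theory Submission
  imports Defs
begin

text \<open>Since every dependent set contains a circuit and the maximum of a set lies above \<open>c\<close> as soon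
  as some element does, \<open>\<Psi>\<close> is in QC iff \<open>C\<^sub>1 \<union> C\<^sub>2 - {c}\<close> is dependent for all circuits
  \<open>C\<^sub>1\<close>, \<open>C\<^sub>2\<close> containing \<open>c\<close> with some element of their symmetric difference above \<open>c\<close>.
  In this form the closure properties follow from a description of the circuits: those of a
  join are the images of the circuits of the two factors, those of a restriction are the
  circuits contained in \<open>U\<close>, and those of a contraction of \<open>I\<close> are of the form \<open>D - I\<close> with \<open>D\<close> a
  circuit. If a pure shifted complex violated the condition, a basis containing
  \<open>C\<^sub>1 \<union> C\<^sub>2 - {c}\<close> could be shifted to a basis containing one of the two circuits.\<close>

section \<open>Simplicial complexes, circuits and bases\<close>

lemma simplicial_complexD:
  assumes "simplicial_complex E \<Delta>"
  shows "finite E" and "{} \<in> \<Delta>" and "\<And>I. I \<in> \<Delta> \<Longrightarrow> I \<subseteq> E"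
    and "\<And>I J. I \<in> \<Delta> \<Longrightarrow> J \<subseteq> I \<Longrightarrow> J \<in> \<Delta>"
  using assms unfolding simplicial_complex_def by blast+

lemma circuitD:
  assumes "C \<in> circuits E \<Delta>"
  shows "C \<subseteq> E" and "C \<notin> \<Delta>" and "\<And>D. D \<subset> C \<Longrightarrow> D \<in> \<Delta>"
  using assms unfolding circuits_def by blast+

lemma circuit_eqI: "C \<in> circuits E \<Delta> \<Longrightarrow> D \<subseteq> C \<Longrightarrow> D \<notin> \<Delta> \<Longrightarrow> D = C"
  unfolding circuits_def by blast

lemma dependent_contains_circuit:
  assumes "finite E" "A \<subseteq> E" "A \<notin> \<Delta>"
  obtains C where "C \<in> circuits E \<Delta>" "C \<subseteq> A"
proof -
  have "finite {D. D \<subseteq> A \<and> D \<notin> \<Delta>}"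
    using assms by (auto intro: finite_subset[of _ "Pow A"] simp: finite_subset)
  from finite_has_minimal2[OF this, of A] assms
  obtain C where "C \<subseteq> A" "C \<notin> \<Delta>" "\<forall>D. D \<subseteq> A \<and> D \<notin> \<Delta> \<longrightarrow> D \<subseteq> C \<longrightarrow> C = D"
    by auto
  then have "C \<in> circuits E \<Delta>" using assms(2) unfolding circuits_def by blast
  with \<open>C \<subseteq> A\<close> show thesis by (rule that[rotated])
qed

lemma independent_in_basis:
  assumes "simplicial_complex E \<Delta>" "I \<in> \<Delta>"
  obtains B where "B \<in> bases \<Delta>" "I \<subseteq> B"
proof -
  have "\<Delta> \<subseteq> Pow E" "finite E" using assms(1) unfolding simplicial_complex_def by auto
  then have "finite \<Delta>" by (meson finite_Pow_iff finite_subset)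
  from finite_has_maximal2[OF this assms(2)]
  obtain B where "B \<in> \<Delta>" "I \<subseteq> B" "\<forall>J\<in>\<Delta>. B \<subseteq> J \<longrightarrow> B = J" by auto
  then show thesis using that[of B] unfolding bases_def by blast
qed

section \<open>Maxima, and the QC condition without them\<close>

lemma max_wrt:
  assumes "linear_order_on E r" "finite A" "A \<noteq> {}" "A \<subseteq> E"
  shows "max_wrt r A \<in> A" and "\<And>x. x \<in> A \<Longrightarrow> (x, max_wrt r A) \<in> r"
proof -
  have r: "refl_on E r" "trans r" "antisym r" "total_on E r"
    using assms(1) by (auto simp: order_on_defs)
  have "\<exists>m\<in>A. \<forall>x\<in>A. (x, m) \<in> r" using assms(2-4)
  proof (induction rule: finite_ne_induct)
    case (singleton x)
    then show ?case using r(1) by (auto simp: refl_on_def)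
  next
    case (insert x F)
    then obtain m where m: "m \<in> F" "\<forall>y\<in>F. (y, m) \<in> r" by auto
    have "x \<in> E" "m \<in> E" "(x, x) \<in> r" using insert.prems m r(1) by (auto simp: refl_on_def)
    then consider "(x, m) \<in> r" | "(m, x) \<in> r"
      using r(4) unfolding total_on_def by metis
    then show ?case
    proof cases
      case 1
      then show ?thesis using m by auto
    next
      case 2
      then show ?thesis using m \<open>(x, x) \<in> r\<close> r(2) by (auto dest: transD)
    qed
  qed
  \<comment> \<open>Existence was shown by induction on the finite set; antisymmetry gives
    uniqueness, so the definite description in \<open>max_wrt\<close> denotes.\<close>
  then have "\<exists>!m. m \<in> A \<and> (\<forall>x\<in>A. (x, m) \<in> r)"
    using r(3) by (auto dest: antisymD)
  from theI'[OF this] show "max_wrt r A \<in> A" "\<And>x. x \<in> A \<Longrightarrow> (x, max_wrt r A) \<in> r"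
    unfolding max_wrt_def by auto
qed

lemma lt_max_wrt_iff:
  assumes "linear_order_on E r" "finite A" "A \<noteq> {}" "A \<subseteq> E"
  shows "lt r c (max_wrt r A) \<longleftrightarrow> (\<exists>m\<in>A. lt r c m)"
proof
  assume "\<exists>m\<in>A. lt r c m"
  then obtain m where m: "m \<in> A" "(c, m) \<in> r" "c \<noteq> m" unfolding lt_def by auto
  have "(m, max_wrt r A) \<in> r" using max_wrt(2)[OF assms] m(1) by blast
  moreover have "trans r" "antisym r" using assms(1) by (auto simp: order_on_defs)
  ultimately show "lt r c (max_wrt r A)"
    using m(2,3) unfolding lt_def by (metis antisymD transD)
qed (use max_wrt(1)[OF assms] in blast)

lemma mem_QC_iff:
  "\<Psi> \<in> QC \<longleftrightarrow> ordered_complex \<Psi> \<and>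
    (\<forall>C\<^sub>1 \<in> circuits (ground \<Psi>) (indep \<Psi>). \<forall>C\<^sub>2 \<in> circuits (ground \<Psi>) (indep \<Psi>).
      \<forall>c \<in> C\<^sub>1 \<inter> C\<^sub>2. \<forall>m \<in> sym_diff C\<^sub>1 C\<^sub>2.
        lt (order_rel \<Psi>) c m \<longrightarrow> C\<^sub>1 \<union> C\<^sub>2 - {c} \<notin> indep \<Psi>)"
proof (cases "ordered_complex \<Psi>")
  case True
  let ?E = "ground \<Psi>" and ?\<Delta> = "indep \<Psi>" and ?r = "order_rel \<Psi>"
  have sc: "simplicial_complex ?E ?\<Delta>" and lin: "linear_order_on ?E ?r"
    using True by (auto simp: ordered_complex_def)
  have "(C\<^sub>1 \<noteq> C\<^sub>2 \<and> lt ?r c (max_wrt ?r (sym_diff C\<^sub>1 C\<^sub>2)) \<longrightarrow>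
          (\<exists>C\<^sub>3 \<in> circuits ?E ?\<Delta>. C\<^sub>3 \<subseteq> (C\<^sub>1 \<union> C\<^sub>2) - {c})) \<longleftrightarrow>
        (\<forall>m \<in> sym_diff C\<^sub>1 C\<^sub>2. lt ?r c m \<longrightarrow> C\<^sub>1 \<union> C\<^sub>2 - {c} \<notin> ?\<Delta>)"
    if C: "C\<^sub>1 \<in> circuits ?E ?\<Delta>" "C\<^sub>2 \<in> circuits ?E ?\<Delta>" for C\<^sub>1 C\<^sub>2 c
  proof -
    have sub: "C\<^sub>1 \<subseteq> ?E" "C\<^sub>2 \<subseteq> ?E" using C by (auto dest: circuitD)
    have "(\<exists>C\<^sub>3 \<in> circuits ?E ?\<Delta>. C\<^sub>3 \<subseteq> (C\<^sub>1 \<union> C\<^sub>2) - {c}) \<longleftrightarrow> C\<^sub>1 \<union> C\<^sub>2 - {c} \<notin> ?\<Delta>"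
    proof
      assume "C\<^sub>1 \<union> C\<^sub>2 - {c} \<notin> ?\<Delta>"
      moreover have "C\<^sub>1 \<union> C\<^sub>2 - {c} \<subseteq> ?E" using sub by blast
      ultimately obtain C\<^sub>3 where "C\<^sub>3 \<in> circuits ?E ?\<Delta>" "C\<^sub>3 \<subseteq> C\<^sub>1 \<union> C\<^sub>2 - {c}"
        using dependent_contains_circuit[OF simplicial_complexD(1)[OF sc]] by metis
      then show "\<exists>C\<^sub>3 \<in> circuits ?E ?\<Delta>. C\<^sub>3 \<subseteq> (C\<^sub>1 \<union> C\<^sub>2) - {c}" by (rule bexI[rotated])
    next
      assume "\<exists>C\<^sub>3 \<in> circuits ?E ?\<Delta>. C\<^sub>3 \<subseteq> (C\<^sub>1 \<union> C\<^sub>2) - {c}"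
      then show "C\<^sub>1 \<union> C\<^sub>2 - {c} \<notin> ?\<Delta>"
        using circuitD(2) simplicial_complexD(4)[OF sc] by metis
    qed
    \<comment> \<open>For equal circuits the symmetric difference is empty and both sides are false,
      so the unspecified value of \<open>max_wrt\<close> on the empty set does no harm.\<close>
    moreover have "C\<^sub>1 \<noteq> C\<^sub>2 \<and> lt ?r c (max_wrt ?r (sym_diff C\<^sub>1 C\<^sub>2)) \<longleftrightarrow>
        (\<exists>m\<in>sym_diff C\<^sub>1 C\<^sub>2. lt ?r c m)"
    proof (cases "C\<^sub>1 = C\<^sub>2")
      case False
      have "finite (sym_diff C\<^sub>1 C\<^sub>2)" "sym_diff C\<^sub>1 C\<^sub>2 \<noteq> {}" "sym_diff C\<^sub>1 C\<^sub>2 \<subseteq> ?E"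
        using sub False simplicial_complexD(1)[OF sc] by (auto dest: finite_subset)
      from lt_max_wrt_iff[OF lin this] False show ?thesis by simp
    qed simp
    ultimately show ?thesis by blast
  qed
  then show ?thesis using True unfolding QC_def by simp
qed (simp add: QC_def)

text \<open>The condition is symmetric in the two circuits, so after a swap the element
  \<open>m\<close> above \<open>c\<close> may be taken in \<open>C\<^sub>1\<close>.\<close>

lemma QC_I:
  assumes "ordered_complex \<Psi>"
    and "\<And>C\<^sub>1 C\<^sub>2 c m. \<lbrakk>C\<^sub>1 \<in> circuits (ground \<Psi>) (indep \<Psi>); C\<^sub>2 \<in> circuits (ground \<Psi>) (indep \<Psi>);
      c \<in> C\<^sub>1; c \<in> C\<^sub>2; m \<in> C\<^sub>1; m \<notin> C\<^sub>2; lt (order_rel \<Psi>) c m; C\<^sub>1 \<union> C\<^sub>2 - {c} \<in> indep \<Psi>\<rbrakk> \<Longrightarrow> False"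
  shows "\<Psi> \<in> QC"
  unfolding mem_QC_iff
proof (intro conjI ballI impI notI)
  fix C\<^sub>1 C\<^sub>2 c m
  assume "C\<^sub>1 \<in> circuits (ground \<Psi>) (indep \<Psi>)" "C\<^sub>2 \<in> circuits (ground \<Psi>) (indep \<Psi>)"
    "c \<in> C\<^sub>1 \<inter> C\<^sub>2" "m \<in> sym_diff C\<^sub>1 C\<^sub>2" "lt (order_rel \<Psi>) c m" "C\<^sub>1 \<union> C\<^sub>2 - {c} \<in> indep \<Psi>"
  then show False using assms(2)[of C\<^sub>1 C\<^sub>2 c m] assms(2)[of C\<^sub>2 C\<^sub>1 c m] by (auto simp: Un_commute)
qed (fact assms(1))

lemma QC_D:
  assumes "\<Psi> \<in> QC" "C\<^sub>1 \<in> circuits (ground \<Psi>) (indep \<Psi>)" "C\<^sub>2 \<in> circuits (ground \<Psi>) (indep \<Psi>)"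
    and "c \<in> C\<^sub>1" "c \<in> C\<^sub>2" "m \<in> C\<^sub>1" "m \<notin> C\<^sub>2" "lt (order_rel \<Psi>) c m"
  shows "C\<^sub>1 \<union> C\<^sub>2 - {c} \<notin> indep \<Psi>"
proof -
  have "c \<in> C\<^sub>1 \<inter> C\<^sub>2" "m \<in> sym_diff C\<^sub>1 C\<^sub>2" using assms(4-7) by simp_all
  then show ?thesis using assms(1-3,8) unfolding mem_QC_iff by metis
qed

lemma QC_ordered_complex: "\<Psi> \<in> QC \<Longrightarrow> ordered_complex \<Psi>"
  by (simp add: QC_def)

section \<open>Restrictions and contractions\<close>

lemma linear_order_on_Restr:
  assumes "linear_order_on E r" "U \<subseteq> E"
  shows "linear_order_on U (Restr r U)"
proof -
  have "refl_on E r" "trans r" "antisym r" "total_on E r"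
    using assms(1) by (auto simp: order_on_defs)
  then show ?thesis using assms(2)
    by (auto simp: order_on_defs refl_on_def total_on_def trans_Restr antisym_def; blast)
qed

lemma lt_Restr: "lt (Restr r U) x y \<Longrightarrow> lt r x y"
  by (simp add: lt_def)

lemma restriction_in_QC:
  assumes "\<Psi> \<in> QC" "U \<subseteq> ground \<Psi>"
  shows "restriction \<Psi> U \<in> QC"
proof (rule QC_I)
  have "ordered_complex \<Psi>" using assms(1) by (rule QC_ordered_complex)
  then show "ordered_complex (restriction \<Psi> U)"
    using assms(2) finite_subset unfolding ordered_complex_def restriction_def simplicial_complex_def
    by (auto intro: linear_order_on_Restr)
next
  fix C\<^sub>1 C\<^sub>2 c m
  let ?R = "restriction \<Psi> U"
  assume C: "C\<^sub>1 \<in> circuits (ground ?R) (indep ?R)" "C\<^sub>2 \<in> circuits (ground ?R) (indep ?R)"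
    and c: "c \<in> C\<^sub>1" "c \<in> C\<^sub>2" "m \<in> C\<^sub>1" "m \<notin> C\<^sub>2" "lt (order_rel ?R) c m"
    and ind: "C\<^sub>1 \<union> C\<^sub>2 - {c} \<in> indep ?R"
  \<comment> \<open>All subsets of \<open>C\<close> lie in \<open>U\<close>, where independence in
    the restriction and in \<open>\<Psi>\<close> agree; hence minimality transfers.\<close>
  have "C \<in> circuits (ground \<Psi>) (indep \<Psi>)" if "C \<in> circuits (ground ?R) (indep ?R)" for C
    using that assms(2) unfolding circuits_def restriction_def by auto
  moreover have "lt (order_rel \<Psi>) c m" using c(5) by (auto simp: restriction_def dest: lt_Restr)
  ultimately have "C\<^sub>1 \<union> C\<^sub>2 - {c} \<notin> indep \<Psi>"
    using QC_D[OF assms(1), of C\<^sub>1 C\<^sub>2 c m] C c by blast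
  then show False using ind by (simp add: restriction_def)
qed

text \<open>\<open>C \<union> I\<close> is dependent and so contains a circuit \<open>D\<close>.
  Since \<open>D\<close> lies in \<open>(D - I) \<union> I\<close>, the part \<open>D - I\<close> of
  \<open>C\<close> is dependent in the contraction, and minimality of \<open>C\<close> makes it all
  of \<open>C\<close>.\<close>

lemma circuit_of_contraction:
  assumes "simplicial_complex E \<Delta>" "I \<in> \<Delta>"
    and "C \<in> circuits (E - I) {J. J \<subseteq> E - I \<and> J \<union> I \<in> \<Delta>}"
  obtains D where "D \<in> circuits E \<Delta>" "D - I = C"
proof -
  note C = circuitD[OF assms(3)]
  have "C \<union> I \<notin> \<Delta>" "C \<union> I \<subseteq> E"
    using C simplicial_complexD(3)[OF assms(1,2)] by auto
  then obtain D where D: "D \<in> circuits E \<Delta>" "D \<subseteq> C \<union> I"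
    using dependent_contains_circuit[OF simplicial_complexD(1)[OF assms(1)]] by metis
  have "D - I \<union> I \<notin> \<Delta>"
    using circuitD(2)[OF D(1)] simplicial_complexD(4)[OF assms(1), of "D - I \<union> I" D] by blast
  then have "D - I = C" using circuit_eqI[OF assms(3), of "D - I"] D(2) by blast
  with D(1) show thesis by (rule that)
qed

lemma contraction_in_QC:
  assumes "\<Psi> \<in> QC" "I \<in> indep \<Psi>"
  shows "contraction \<Psi> I \<in> QC"
proof (rule QC_I)
  have oc: "ordered_complex \<Psi>" using assms(1) by (rule QC_ordered_complex)
  then have sc: "simplicial_complex (ground \<Psi>) (indep \<Psi>)"
    and lin: "linear_order_on (ground \<Psi>) (order_rel \<Psi>)" by (auto simp: ordered_complex_def)
  let ?K = "contraction \<Psi> I"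
  show "ordered_complex ?K"
    unfolding ordered_complex_def simplicial_complex_def
    using simplicial_complexD[OF sc] assms(2) linear_order_on_Restr[OF lin, of "ground \<Psi> - I"]
    by (auto simp: contraction_def) (meson Un_mono order_refl)
  fix C\<^sub>1 C\<^sub>2 c m
  assume C: "C\<^sub>1 \<in> circuits (ground ?K) (indep ?K)" "C\<^sub>2 \<in> circuits (ground ?K) (indep ?K)"
    and c: "c \<in> C\<^sub>1" "c \<in> C\<^sub>2" "m \<in> C\<^sub>1" "m \<notin> C\<^sub>2" "lt (order_rel ?K) c m"
    and ind: "C\<^sub>1 \<union> C\<^sub>2 - {c} \<in> indep ?K"
  obtain D\<^sub>1 where D1: "D\<^sub>1 \<in> circuits (ground \<Psi>) (indep \<Psi>)" "D\<^sub>1 - I = C\<^sub>1"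
    using circuit_of_contraction[OF sc assms(2)] C(1) by (auto simp: contraction_def)
  obtain D\<^sub>2 where D2: "D\<^sub>2 \<in> circuits (ground \<Psi>) (indep \<Psi>)" "D\<^sub>2 - I = C\<^sub>2"
    using circuit_of_contraction[OF sc assms(2)] C(2) by (auto simp: contraction_def)
  \<comment> \<open>Both \<open>c\<close> and \<open>m\<close> lie outside \<open>I\<close>, so
    passing from \<open>C\<^sub>1\<close> and \<open>C\<^sub>2\<close> to \<open>D\<^sub>1\<close>
    and \<open>D\<^sub>2\<close> changes nothing about which circuit contains them.\<close>
  have "lt (order_rel \<Psi>) c m" using c(5) by (auto simp: contraction_def dest: lt_Restr)
  then have "D\<^sub>1 \<union> D\<^sub>2 - {c} \<notin> indep \<Psi>"
    using QC_D[OF assms(1) D1(1) D2(1), of c m] c D1(2) D2(2) by blast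
  moreover have "D\<^sub>1 \<union> D\<^sub>2 - {c} \<subseteq> (C\<^sub>1 \<union> C\<^sub>2 - {c}) \<union> I" using D1(2) D2(2) by blast
  ultimately show False
    using ind simplicial_complexD(4)[OF sc] by (auto simp: contraction_def)
qed

section \<open>Joins along shuffles\<close>

lemma shuffle_commute: "shuffle E r E' r' S s j j' \<longleftrightarrow> shuffle E' r' E r S s j' j"
  unfolding shuffle_def by blast

lemma join_commute: "join S s j j' \<Psi> \<Psi>' = join S s j' j \<Psi>' \<Psi>"
  unfolding join_def by (auto; blast)

lemma inj_on_image_subset_cancel:
  assumes "inj_on f E" "A \<subseteq> E" "B \<subseteq> E" "f ` B \<subseteq> f ` A"
  shows "B \<subseteq> A"
proof
  fix x assume "x \<in> B"
  then show "x \<in> A" using inj_on_image_mem_iff[OF assms(1) _ assms(2)] assms(3,4) by blast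
qed

locale shuffled_complexes =
  fixes \<Psi> :: "'a ordered_complex" and \<Psi>' :: "'b ordered_complex"
    and S :: "'c set" and s j j'
  assumes oc: "ordered_complex \<Psi>" and oc': "ordered_complex \<Psi>'"
    and sh: "shuffle (ground \<Psi>) (order_rel \<Psi>) (ground \<Psi>') (order_rel \<Psi>') S s j j'"
begin

abbreviation "J \<equiv> join S s j j' \<Psi> \<Psi>'"

text \<open>The locale is symmetric in its two factors: facts proved for the left factor reach the
  right one by interpreting this instance.\<close>

lemma swap: "shuffled_complexes \<Psi>' \<Psi> S s j' j"
  using oc oc' sh shuffle_commute by unfold_locales blast+

lemma sc: "simplicial_complex (ground \<Psi>) (indep \<Psi>)"
  and sc': "simplicial_complex (ground \<Psi>') (indep \<Psi>')"
  using oc oc' by (auto simp: ordered_complex_def)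

lemma images: "inj_on j (ground \<Psi>)" "inj_on j' (ground \<Psi>')"
  "j ` ground \<Psi> \<inter> j' ` ground \<Psi>' = {}" "j ` ground \<Psi> \<union> j' ` ground \<Psi>' = S"
  using sh unfolding shuffle_def by auto

lemma sel: "ground J = S" "order_rel J = s"
  by (simp_all add: join_def)

text \<open>The images of the ground sets are disjoint and both maps are injective, so a set in the
  join determines its two parts uniquely.\<close>

lemma indep_join_iff:
  assumes "A \<subseteq> ground \<Psi>" "A' \<subseteq> ground \<Psi>'"
  shows "j ` A \<union> j' ` A' \<in> indep J \<longleftrightarrow> A \<in> indep \<Psi> \<and> A' \<in> indep \<Psi>'"
proof
  assume "j ` A \<union> j' ` A' \<in> indep J"
  then obtain I I' where I: "I \<in> indep \<Psi>" "I' \<in> indep \<Psi>'" "j ` A \<union> j' ` A' = j ` I \<union> j' ` I'"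
    unfolding join_def by auto
  have sub: "I \<subseteq> ground \<Psi>" "I' \<subseteq> ground \<Psi>'"
    using I simplicial_complexD(3)[OF sc] simplicial_complexD(3)[OF sc'] by auto
  have "j ` A = j ` I" "j' ` A' = j' ` I'"
    using I(3) images(3) assms sub by blast+
  then have "A = I" "A' = I'"
    using inj_on_image_eq_iff images(1,2) assms sub by metis+
  then show "A \<in> indep \<Psi> \<and> A' \<in> indep \<Psi>'" using I by simp
qed (auto simp: join_def)

lemma subset_join:
  assumes "C \<subseteq> S"
  obtains A A' where "A \<subseteq> ground \<Psi>" "A' \<subseteq> ground \<Psi>'" "C = j ` A \<union> j' ` A'"
proof (rule that)
  show "C = j ` {x \<in> ground \<Psi>. j x \<in> C} \<union> j' ` {x \<in> ground \<Psi>'. j' x \<in> C}"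
    using assms images(4) by auto
qed auto

lemma indep_image_iff: "A \<subseteq> ground \<Psi> \<Longrightarrow> j ` A \<in> indep J \<longleftrightarrow> A \<in> indep \<Psi>"
  using indep_join_iff[of A "{}"] simplicial_complexD(2)[OF sc'] by simp

lemma circuit_of_image:
  assumes "A \<subseteq> ground \<Psi>" "j ` A \<in> circuits S (indep J)"
  shows "A \<in> circuits (ground \<Psi>) (indep \<Psi>)"
proof -
  have "D \<in> indep \<Psi>" if "D \<subset> A" for D
  proof -
    have "j ` D \<subset> j ` A"
      using that assms(1) images(1) inj_on_image_eq_iff[of j "ground \<Psi>" D A] by blast
    then show ?thesis using circuitD(3)[OF assms(2)] indep_image_iff that assms(1) by blast
  qed
  moreover have "A \<notin> indep \<Psi>" using circuitD(2)[OF assms(2)] indep_image_iff assms(1) by blast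
  ultimately show ?thesis using assms(1) unfolding circuits_def by blast
qed

text \<open>If the circuit is \<open>j\<close> A \<union> j' \<open>A'\<close>, then
  \<open>A\<close> or \<open>A'\<close> is dependent. The image of that part is already dependent in
  the join, so by minimality it is the whole circuit.\<close>

lemma circuit_join_cases:
  assumes "C \<in> circuits S (indep J)"
  obtains (left) A where "A \<in> circuits (ground \<Psi>) (indep \<Psi>)" "C = j ` A"
    | (right) A' where "A' \<in> circuits (ground \<Psi>') (indep \<Psi>')" "C = j' ` A'"
proof -
  interpret sw: shuffled_complexes \<Psi>' \<Psi> S s j' j by (rule swap)
  obtain A A' where A: "A \<subseteq> ground \<Psi>" "A' \<subseteq> ground \<Psi>'" "C = j ` A \<union> j' ` A'"
    using subset_join[OF circuitD(1)[OF assms]] by metis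
  have J: "sw.J = J" by (rule join_commute[symmetric])
  consider "A \<notin> indep \<Psi>" | "A' \<notin> indep \<Psi>'"
    using circuitD(2)[OF assms] indep_join_iff A by blast
  then show thesis
  proof cases
    case 1
    then have "C = j ` A"
      using circuit_eqI[OF assms, of "j ` A"] indep_image_iff A by blast
    then show thesis using left circuit_of_image A(1) assms by blast
  next
    case 2
    then have "C = j' ` A'"
      using circuit_eqI[OF assms, of "j' ` A'"] sw.indep_image_iff A unfolding J by blast
    then show thesis using right sw.circuit_of_image[of A'] A(2) assms unfolding J by blast
  qed
qed

lemma ordered_complex_join: "ordered_complex J"
proof -
  have "finite S"
    using images(4) simplicial_complexD(1)[OF sc] simplicial_complexD(1)[OF sc'] by blast
  moreover have "indep J \<subseteq> Pow S"
    using simplicial_complexD(3)[OF sc] simplicial_complexD(3)[OF sc'] images(4)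
    unfolding join_def by fastforce
  moreover have "{} \<in> indep J"
    using indep_image_iff[of "{}"] simplicial_complexD(2)[OF sc] by simp
  moreover have "K \<in> indep J" if K: "L \<in> indep J" "K \<subseteq> L" for K L
  proof -
    have "L \<subseteq> S" using calculation(2) K(1) by blast
    then have "K \<subseteq> S" using K(2) by blast
    obtain A A' where A: "A \<subseteq> ground \<Psi>" "A' \<subseteq> ground \<Psi>'" "L = j ` A \<union> j' ` A'"
      using subset_join[OF \<open>L \<subseteq> S\<close>] .
    obtain B B' where B: "B \<subseteq> ground \<Psi>" "B' \<subseteq> ground \<Psi>'" "K = j ` B \<union> j' ` B'"
      using subset_join[OF \<open>K \<subseteq> S\<close>] .
    \<comment> \<open>Disjointness of the images splits the inclusion of \<open>K\<close> in
      \<open>L\<close> into one inclusion per factor; injectivity then pulls each back to the ground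
      set of its factor.\<close>
    have "j ` B \<inter> j' ` A' = {}" "j' ` B' \<inter> j ` A = {}"
      using images(3) A(1,2) B(1,2) by blast+
    moreover have "X \<subseteq> Y" if "X \<subseteq> Y \<union> Z" "X \<inter> Z = {}" for X Y Z :: "'c set"
      using that by blast
    ultimately have "j ` B \<subseteq> j ` A" "j' ` B' \<subseteq> j' ` A'"
      using K(2) unfolding A(3) B(3) by (metis Un_commute Un_subset_iff)+
    then have "B \<subseteq> A" "B' \<subseteq> A'"
      using inj_on_image_subset_cancel images(1,2) A(1,2) B(1,2) by metis+
    moreover have "A \<in> indep \<Psi>" "A' \<in> indep \<Psi>'"
      using indep_join_iff[OF A(1,2)] A(3) K(1) by simp_all
    ultimately have "B \<in> indep \<Psi>" "B' \<in> indep \<Psi>'"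
      using simplicial_complexD(4)[OF sc] simplicial_complexD(4)[OF sc'] by blast+
    then show ?thesis using indep_join_iff[OF B(1,2)] B(3) by simp
  qed
  moreover have "linear_order_on S s" using sh by (simp add: shuffle_def)
  ultimately show ?thesis
    unfolding ordered_complex_def simplicial_complex_def using sel by auto
qed

text \<open>A shuffle is only assumed to preserve order. Reflection comes from totality: the
  opposite relation between \<open>x\<close> and \<open>y\<close> would be preserved and contradict
  antisymmetry of \<open>s\<close>.\<close>

lemma lt_of_image:
  assumes "x \<in> ground \<Psi>" "y \<in> ground \<Psi>" "lt s (j x) (j y)"
  shows "lt (order_rel \<Psi>) x y"
proof -
  have "(j y, j x) \<notin> s"
    using assms(3) sh unfolding shuffle_def order_on_defs lt_def by (metis antisymD)
  then have "(y, x) \<notin> order_rel \<Psi>" using sh unfolding shuffle_def by blast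
  moreover have "total_on (ground \<Psi>) (order_rel \<Psi>)"
    using oc by (auto simp: ordered_complex_def order_on_defs)
  moreover have "x \<noteq> y" using assms(3) by (auto simp: lt_def)
  ultimately show ?thesis using assms(1,2) unfolding total_on_def lt_def by blast
qed

text \<open>The shared element \<open>c\<close> lies in the image of the left factor, so by
  disjointness \<open>C\<^sub>2\<close> comes from that factor too. The elimination then takes place
  inside \<open>\<Psi>\<close> and is transported along \<open>j\<close>.\<close>

lemma elimination_left:
  assumes "\<Psi> \<in> QC" "A\<^sub>1 \<in> circuits (ground \<Psi>) (indep \<Psi>)" "C\<^sub>2 \<in> circuits S (indep J)"
    and "c \<in> j ` A\<^sub>1" "c \<in> C\<^sub>2" "m \<in> j ` A\<^sub>1" "m \<notin> C\<^sub>2" "lt s c m"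
  shows "j ` A\<^sub>1 \<union> C\<^sub>2 - {c} \<notin> indep J"
proof -
  have A1: "A\<^sub>1 \<subseteq> ground \<Psi>" using assms(2) by (rule circuitD)
  obtain x y where x: "x \<in> A\<^sub>1" "c = j x" and y: "y \<in> A\<^sub>1" "m = j y" using assms by blast
  from assms(3) show ?thesis
  proof (cases rule: circuit_join_cases)
    case (left A\<^sub>2)
    have A2: "A\<^sub>2 \<subseteq> ground \<Psi>" using left(1) by (rule circuitD)
    have "x \<in> A\<^sub>2" "y \<notin> A\<^sub>2"
      using assms(5,7) left(2) x y A1 A2 images(1) by (auto dest: inj_onD)
    moreover have "lt (order_rel \<Psi>) x y" using lt_of_image x y A1 assms(8) by blast
    ultimately have "A\<^sub>1 \<union> A\<^sub>2 - {x} \<notin> indep \<Psi>"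
      using QC_D[OF assms(1,2) left(1)] x y by blast
    moreover have "j ` (A\<^sub>1 \<union> A\<^sub>2 - {x}) = j ` A\<^sub>1 \<union> C\<^sub>2 - {c}"
      \<comment> \<open>By injectivity, removing \<open>x\<close> before applying \<open>j\<close>
        is the same as removing \<open>c = j x\<close> afterwards.\<close>
      using inj_on_image_set_diff[OF images(1), of "A\<^sub>1 \<union> A\<^sub>2" "{x}"] A1 A2 x left(2)
      by (simp add: image_Un Diff_subset[THEN order_trans] subsetD)
    moreover have "A\<^sub>1 \<union> A\<^sub>2 - {x} \<subseteq> ground \<Psi>" using A1 A2 by blast
    ultimately show ?thesis using indep_image_iff by metis
  next
    case (right A')
    have "c \<in> j ` ground \<Psi>" using A1 x by simp blast
    moreover have "c \<in> j' ` ground \<Psi>'"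
      using image_mono[OF circuitD(1)[OF right(1)]] assms(5) unfolding right(2) by (rule subsetD)
    ultimately show ?thesis using images(3) by blast
  qed
qed

end

lemma join_in_QC:
  assumes "\<Psi> \<in> QC" "\<Psi>' \<in> QC"
    and "shuffle (ground \<Psi>) (order_rel \<Psi>) (ground \<Psi>') (order_rel \<Psi>') S s j j'"
  shows "join S s j j' \<Psi> \<Psi>' \<in> QC"
proof (rule QC_I)
  interpret shuffled_complexes \<Psi> \<Psi>' S s j j'
    by (rule shuffled_complexes.intro) (rule assms(1,2)[THEN QC_ordered_complex] assms(3))+
  interpret sw: shuffled_complexes \<Psi>' \<Psi> S s j' j by (rule swap)
  show "ordered_complex J" by (rule ordered_complex_join)
  have J: "sw.J = J" by (rule join_commute[symmetric])
  fix C\<^sub>1 C\<^sub>2 c m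
  assume C: "C\<^sub>1 \<in> circuits (ground J) (indep J)" "C\<^sub>2 \<in> circuits (ground J) (indep J)"
    and c: "c \<in> C\<^sub>1" "c \<in> C\<^sub>2" "m \<in> C\<^sub>1" "m \<notin> C\<^sub>2" "lt (order_rel J) c m"
    and ind: "C\<^sub>1 \<union> C\<^sub>2 - {c} \<in> indep J"
  note facts = C c ind
  from C(1)[unfolded sel] show False
  proof (cases rule: circuit_join_cases)
    case (left A)
    then show False using elimination_left[OF assms(1), of A C\<^sub>2 c m] facts unfolding sel by blast
  next
    case (right A)
    then show False
      using sw.elimination_left[OF assms(2), of A C\<^sub>2 c m] facts unfolding sel J by blast
  qed
qed

section \<open>Ordered matroids, shifted complexes, and complexes in QC for every ordering\<close>

lemma matroid_circuit_elimination:
  assumes "matroid_complex E \<Delta>" "C\<^sub>1 \<in> circuits E \<Delta>" "C\<^sub>2 \<in> circuits E \<Delta>" "C\<^sub>1 \<noteq> C\<^sub>2" "c \<in> C\<^sub>1"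
  shows "C\<^sub>1 \<union> C\<^sub>2 - {c} \<notin> \<Delta>"
proof
  assume ind: "C\<^sub>1 \<union> C\<^sub>2 - {c} \<in> \<Delta>"
  have sc: "simplicial_complex E \<Delta>"
    and aug: "\<And>I J. I \<in> \<Delta> \<Longrightarrow> J \<in> \<Delta> \<Longrightarrow> card I < card J \<Longrightarrow> \<exists>x\<in>J - I. insert x I \<in> \<Delta>"
    using assms(1) unfolding matroid_complex_def by blast+
  note C1 = circuitD[OF assms(2)] and C2 = circuitD[OF assms(3)]
  have fin: "finite (C\<^sub>1 \<union> C\<^sub>2)"
    using C1(1) C2(1) simplicial_complexD(1)[OF sc] by (meson Un_least finite_subset)
  obtain f where f: "f \<in> C\<^sub>2" "f \<notin> C\<^sub>1"
    using circuit_eqI[OF assms(2) _ C2(2)] assms(4) by blast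
  \<comment> \<open>A maximal independent subset \<open>I\<close> of the union that extends
    \<open>C\<^sub>2 - {f}\<close> must omit \<open>f\<close>, or it would contain
    \<open>C\<^sub>2\<close>, and must also omit some \<open>g\<close> of
    \<open>C\<^sub>1\<close>.\<close>
  have "finite (\<Delta> \<inter> Pow (C\<^sub>1 \<union> C\<^sub>2))" "C\<^sub>2 - {f} \<in> \<Delta> \<inter> Pow (C\<^sub>1 \<union> C\<^sub>2)"
    using fin C2(3) f by blast+
  from finite_has_maximal2[OF this]
  obtain I where I: "I \<in> \<Delta>" "C\<^sub>2 - {f} \<subseteq> I" "I \<subseteq> C\<^sub>1 \<union> C\<^sub>2"
    and max: "\<forall>K \<in> \<Delta> \<inter> Pow (C\<^sub>1 \<union> C\<^sub>2). I \<subseteq> K \<longrightarrow> I = K"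
    by blast
  have "f \<notin> I" using simplicial_complexD(4)[OF sc I(1), of C\<^sub>2] C2(2) I(2) by blast
  obtain g where g: "g \<in> C\<^sub>1" "g \<notin> I" using simplicial_complexD(4)[OF sc I(1)] C1(2) by blast
  \<comment> \<open>As \<open>f\<close> is not in \<open>C\<^sub>1\<close>, it differs from
    \<open>g\<close>: \<open>I\<close> misses at least two elements of the union, while the
    supposedly independent set misses only \<open>c\<close>. Augmentation therefore enlarges
    \<open>I\<close> within the union, against maximality.\<close>
  have "card I \<le> card (C\<^sub>1 \<union> C\<^sub>2 - {f, g})"
    using I(3) \<open>f \<notin> I\<close> g(2) fin by (intro card_mono) auto
  also have "\<dots> < card (C\<^sub>1 \<union> C\<^sub>2 - {c})"
  proof -
    have "card (C\<^sub>1 \<union> C\<^sub>2 - {f, g}) = card (C\<^sub>1 \<union> C\<^sub>2) - card {f, g}"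
      using f g by (intro card_Diff_subset) auto
    moreover have "card {f, g} \<le> card (C\<^sub>1 \<union> C\<^sub>2)" using f g fin by (intro card_mono) auto
    moreover have "card {f, g} = 2" using f g by (metis card_2_iff)
    moreover have "card (C\<^sub>1 \<union> C\<^sub>2 - {c}) = card (C\<^sub>1 \<union> C\<^sub>2) - 1"
      using assms(5) by simp
    ultimately show ?thesis by linarith
  qed
  finally obtain x where x: "x \<in> C\<^sub>1 \<union> C\<^sub>2 - {c} - I" "insert x I \<in> \<Delta>"
    using aug[OF I(1) ind] by blast
  then show False using max I(3) by blast
qed

lemma ordered_matroid_in_QC:
  assumes "ordered_matroid \<Psi>"
  shows "\<Psi> \<in> QC"
proof (rule QC_I)
  have "matroid_complex (ground \<Psi>) (indep \<Psi>)" using assms by (simp add: ordered_matroid_def)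
  note elim = matroid_circuit_elimination[OF this]
  fix C\<^sub>1 C\<^sub>2 c m
  assume "C\<^sub>1 \<in> circuits (ground \<Psi>) (indep \<Psi>)" "C\<^sub>2 \<in> circuits (ground \<Psi>) (indep \<Psi>)"
    "c \<in> C\<^sub>1" "m \<in> C\<^sub>1" "m \<notin> C\<^sub>2" "C\<^sub>1 \<union> C\<^sub>2 - {c} \<in> indep \<Psi>"
  then show False using elim[of C\<^sub>1 C\<^sub>2 c] by metis
qed (use assms in \<open>simp add: ordered_matroid_def\<close>)

lemma shifted_in_QC:
  assumes "ordered_complex \<Psi>" "shifted \<Psi>"
  shows "\<Psi> \<in> QC"
proof (rule QC_I[OF assms(1)])
  have sc: "simplicial_complex (ground \<Psi>) (indep \<Psi>)"
    using assms(1) by (simp add: ordered_complex_def)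
  fix C\<^sub>1 C\<^sub>2 c m
  assume C: "C\<^sub>1 \<in> circuits (ground \<Psi>) (indep \<Psi>)" "C\<^sub>2 \<in> circuits (ground \<Psi>) (indep \<Psi>)"
    and c: "c \<in> C\<^sub>1" "c \<in> C\<^sub>2" "m \<in> C\<^sub>1" "m \<notin> C\<^sub>2" "lt (order_rel \<Psi>) c m"
    and ind: "C\<^sub>1 \<union> C\<^sub>2 - {c} \<in> indep \<Psi>"
  obtain B where B: "B \<in> bases (indep \<Psi>)" "C\<^sub>1 \<union> C\<^sub>2 - {c} \<subseteq> B"
    using independent_in_basis[OF sc ind] .
  have "c \<notin> B"
    using B circuitD(2)[OF C(1)] simplicial_complexD(4)[OF sc, of B C\<^sub>1]
    unfolding bases_def by blast
  moreover have "m \<in> B" "c \<in> ground \<Psi>" "m \<in> ground \<Psi>"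
    using B c circuitD(1)[OF C(1)] by auto
  \<comment> \<open>Trading \<open>m\<close> for the smaller \<open>c\<close> loses nothing of
    \<open>C\<^sub>2\<close>, which avoids \<open>m\<close>, and supplies its one possibly missing
    element \<open>c\<close>.\<close>
  ultimately have "B - {m} \<union> {c} \<in> bases (indep \<Psi>)"
    using assms(2) B(1) c(5) unfolding shifted_def by blast
  moreover have "C\<^sub>2 \<subseteq> B - {m} \<union> {c}" using B(2) c(4) by blast
  ultimately have "C\<^sub>2 \<in> indep \<Psi>"
    using simplicial_complexD(4)[OF sc] unfolding bases_def by blast
  then show False using circuitD(2)[OF C(2)] by blast
qed

text \<open>If \<open>I\<close> cannot be augmented from \<open>J\<close>, choose an independent
  \<open>K\<close> inside \<open>I \<union> J\<close> that is larger than \<open>I\<close> and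
  misses as little of \<open>I\<close> as possible. For an \<open>e\<close> in \<open>I - K\<close>,
  elimination of \<open>e\<close> from two circuits inside \<open>insert e K\<close> would leave a
  dependent subset of \<open>K\<close>.\<close>

lemma circuit_elimination_imp_matroid:
  assumes sc: "simplicial_complex E \<Delta>"
    and elim: "\<And>C\<^sub>1 C\<^sub>2 c. \<lbrakk>C\<^sub>1 \<in> circuits E \<Delta>; C\<^sub>2 \<in> circuits E \<Delta>; C\<^sub>1 \<noteq> C\<^sub>2; c \<in> C\<^sub>1; c \<in> C\<^sub>2\<rbrakk>
      \<Longrightarrow> C\<^sub>1 \<union> C\<^sub>2 - {c} \<notin> \<Delta>"
  shows "matroid_complex E \<Delta>"
  unfolding matroid_complex_def
proof (intro conjI ballI impI sc)
  fix I J assume IJ: "I \<in> \<Delta>" "J \<in> \<Delta>" "card I < card J"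
  have fin: "finite K" if "K \<in> \<Delta>" for K
    using simplicial_complexD(1,3)[OF sc] that finite_subset by blast
  define P where "P K \<longleftrightarrow> K \<in> \<Delta> \<and> K \<subseteq> I \<union> J \<and> card I < card K" for K
  show "\<exists>x\<in>J - I. insert x I \<in> \<Delta>"
  proof (rule ccontr)
    assume no_aug: "\<not> ?thesis"
    have "P J" using IJ by (simp add: P_def)
    then obtain K where K: "P K" and min: "\<And>L. P L \<Longrightarrow> card (I - K) \<le> card (I - L)"
      using ex_has_least_nat[of P J "\<lambda>K. card (I - K)"] by blast
    have KD: "K \<in> \<Delta>" "K \<subseteq> I \<union> J" "card I < card K" using K by (auto simp: P_def)
    obtain g where g: "g \<in> K" "g \<notin> I" using KD(3) card_mono[OF fin[OF IJ(1)]] by (meson not_le subsetI)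
    have "\<not> I \<subseteq> K"
    proof
      assume "I \<subseteq> K"
      then have "insert g I \<in> \<Delta>" using simplicial_complexD(4)[OF sc KD(1)] g by blast
      then show False using no_aug g KD(2) by blast
    qed
    then obtain e where e: "e \<in> I" "e \<notin> K" by blast
    \<comment> \<open>Exchanging \<open>f\<close> for \<open>e\<close> keeps the size of
      \<open>K\<close> but misses less of \<open>I\<close>, so the choice of \<open>K\<close> forces
      a dependent set. Its circuit passes through \<open>e\<close>, since otherwise it would lie in
      \<open>K\<close>.\<close>
    have circ: "\<exists>C\<in>circuits E \<Delta>. C \<subseteq> insert e K - {f} \<and> e \<in> C" if f: "f \<in> K" "f \<notin> I" for f
    proof -
      have "card (insert e K - {f}) = card K" using e f fin[OF KD(1)] by auto
      moreover have "card (I - (insert e K - {f})) < card (I - K)"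
        using e f fin[OF IJ(1)] by (intro psubset_card_mono) auto
      ultimately have "insert e K - {f} \<notin> \<Delta>"
        using min[of "insert e K - {f}"] KD e unfolding P_def by auto
      moreover have "insert e K - {f} \<subseteq> E"
        using e simplicial_complexD(3)[OF sc] IJ(1) KD(1) by blast
      ultimately obtain C where C: "C \<in> circuits E \<Delta>" "C \<subseteq> insert e K - {f}"
        using dependent_contains_circuit[OF simplicial_complexD(1)[OF sc]] by metis
      then have "e \<in> C"
        using circuitD(2)[OF C(1)] simplicial_complexD(4)[OF sc KD(1), of C] by blast
      with C show ?thesis by blast
    qed
    obtain C where C: "C \<in> circuits E \<Delta>" "C \<subseteq> insert e K - {g}" "e \<in> C" using circ g by blast
    \<comment> \<open>The circuit \<open>C\<close> is not inside the independent set
      \<open>I\<close>. Removing such an \<open>h\<close> in the second exchange yields a circuit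
      \<open>D\<close> without \<open>h\<close>, hence different from \<open>C\<close>.\<close>
    obtain h where h: "h \<in> C" "h \<notin> I"
      using circuitD(2)[OF C(1)] simplicial_complexD(4)[OF sc IJ(1), of C] by blast
    then have "h \<in> K" using C(2) e by blast
    then obtain D where D: "D \<in> circuits E \<Delta>" "D \<subseteq> insert e K - {h}" "e \<in> D"
      using circ h by blast
    have "C \<union> D - {e} \<notin> \<Delta>" using elim[OF C(1) D(1), of e] C D h by blast
    moreover have "C \<union> D - {e} \<subseteq> K" using C D by blast
    ultimately show False using simplicial_complexD(4)[OF sc KD(1)] by blast
  qed
qed

lemma linear_order_with_greatest:
  assumes "m \<in> X"
  obtains r where "linear_order_on X r" "\<And>x. x \<in> X \<Longrightarrow> (x, m) \<in> r"
proof -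
  \<comment> \<open>The well-order only serves as some linear order of the other elements; adding
    \<open>X \<times> {m}\<close> puts \<open>m\<close> on top and makes it reflexive at
    \<open>m\<close>.\<close>
  obtain w :: "'a rel" where w: "well_order_on (X - {m}) w"
    using well_order_on by blast
  then have "refl_on (X - {m}) w" "w \<subseteq> (X - {m}) \<times> (X - {m})" "trans w" "antisym w" "total_on (X - {m}) w"
    by (auto simp: order_on_defs dest: well_order_on_domain[OF w])
  moreover from this(2,3) have "trans (w \<union> X \<times> {m})"
    by (auto simp: trans_def)
  moreover from calculation(2,4) have "antisym (w \<union> X \<times> {m})"
    by (auto simp: antisym_def)
  moreover from calculation(5) have "total_on X (w \<union> X \<times> {m})"
    by (auto simp: total_on_def)
  ultimately have "linear_order_on X (w \<union> X \<times> {m})"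
    using assms by (auto simp: order_on_defs refl_on_def)
  then show thesis by (rule that) simp
qed

text \<open>The ordering may depend on the circuits. With an element of
  \<open>C\<^sub>1 - C\<^sub>2\<close> as greatest element, the order condition in QC holds for
  every common \<open>c\<close>, so QC yields unrestricted circuit elimination.\<close>

lemma all_orders_QC_imp_matroid:
  assumes sc: "simplicial_complex X \<Delta>"
    and all: "\<And>r. linear_order_on X r \<Longrightarrow> \<lparr>ground = X, order_rel = r, indep = \<Delta>\<rparr> \<in> QC"
  shows "matroid_complex X \<Delta>"
proof (rule circuit_elimination_imp_matroid[OF sc])
  fix C\<^sub>1 C\<^sub>2 c
  assume C: "C\<^sub>1 \<in> circuits X \<Delta>" "C\<^sub>2 \<in> circuits X \<Delta>" "C\<^sub>1 \<noteq> C\<^sub>2" and c: "c \<in> C\<^sub>1" "c \<in> C\<^sub>2"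
  obtain m where m: "m \<in> C\<^sub>1" "m \<notin> C\<^sub>2"
    using circuit_eqI[OF C(2) _ circuitD(2)[OF C(1)]] C(3) by blast
  have X: "m \<in> X" "c \<in> X" using m c circuitD(1)[OF C(1)] by auto
  obtain r where r: "linear_order_on X r" "(c, m) \<in> r"
    using linear_order_with_greatest[OF X(1)] X(2) by metis
  have "c \<noteq> m" using c m by blast
  then show "C\<^sub>1 \<union> C\<^sub>2 - {c} \<notin> \<Delta>"
    using QC_D[OF all[OF r(1)], of C\<^sub>1 C\<^sub>2 c m] C c m r(2) by (simp add: lt_def)
qed

section \<open>Vertices and the axioms of a quasi-matroidal class\<close>

lemma vertex_independent:
  assumes "simplicial_complex E \<Delta>" "v \<in> vertices E \<Delta>"
  shows "{v} \<in> \<Delta>"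
proof -
  obtain B where "B \<in> \<Delta>" "v \<in> B"
    using assms(2) unfolding vertices_def loops_def bases_def by blast
  then show ?thesis using simplicial_complexD(4)[OF assms(1), of B "{v}"] by simp
qed

lemma QC_quasi_matroidal: "quasi_matroidal QC"
  unfolding quasi_matroidal_def
proof (intro conjI ballI allI impI)
  fix X :: "'a set" and \<Delta>
  assume "simplicial_complex X \<Delta> \<and> vertices X \<Delta> = X \<and>
    (\<forall>r. linear_order_on X r \<longrightarrow> \<lparr>ground = X, order_rel = r, indep = \<Delta>\<rparr> \<in> QC)"
  then show "matroid_complex X \<Delta>" by (intro all_orders_QC_imp_matroid) simp_all
next
  fix \<Psi> :: "'a ordered_complex"
  assume "ordered_complex \<Psi> \<and> pure (indep \<Psi>) \<and> shifted \<Psi>"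
  then show "\<Psi> \<in> QC" using shifted_in_QC by blast
next
  fix \<Psi> :: "'a ordered_complex"
  assume "\<Psi> \<in> QC"
  \<comment> \<open>Deletion is by definition a restriction, so closure under restrictions
    applies.\<close>
  then show "deletion \<Psi> (max_wrt (order_rel \<Psi>) (ground \<Psi>)) \<in> QC"
    unfolding deletion_def by (rule restriction_in_QC) blast
qed (fact QC_ordered_complex ordered_matroid_in_QC join_in_QC contraction_in_QC)+

theorem theorem4p15:
  shows "(\<forall>(\<Psi> :: 'a ordered_complex) \<in> QC. \<forall>(\<Psi>' :: 'b ordered_complex) \<in> QC.
            \<forall>(S :: 'c set) s j j'.
              shuffle (ground \<Psi>) (order_rel \<Psi>) (ground \<Psi>') (order_rel \<Psi>') S s j j' \<longrightarrow>
              join S s j j' \<Psi> \<Psi>' \<in> QC) \<and>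
         (\<forall>(\<Psi> :: 'a ordered_complex) \<in> QC. \<forall>U. U \<subseteq> ground \<Psi> \<longrightarrow> restriction \<Psi> U \<in> QC) \<and>
         (\<forall>(\<Psi> :: 'a ordered_complex) \<in> QC.
            \<forall>v \<in> vertices (ground \<Psi>) (indep \<Psi>). contraction \<Psi> {v} \<in> QC) \<and>
         quasi_matroidal (QC :: 'a ordered_complex set)"
proof (intro conjI ballI allI impI)
  fix \<Psi> :: "'a ordered_complex" and v
  assume "\<Psi> \<in> QC" "v \<in> vertices (ground \<Psi>) (indep \<Psi>)"
  then show "contraction \<Psi> {v} \<in> QC"
    by (metis contraction_in_QC vertex_independent QC_ordered_complex ordered_complex_def)
qed (fact join_in_QC restriction_in_QC QC_quasi_matroidal)+

end
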